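(* Let $0<q<1$, let $a$ be a positive real number, and let $u,v>0$ satisfy $au<v$ and be such that the $q$-integral defining $(N_q e_q(at))(u;v)$ exists. Then $$\left(N_q e_q(at)\right)(u;v)=\frac{1}{v-au}.$$
   Context: Fix $0<q<1$. Write $[n]_q=\frac{1-q^n}{1-q}$, $[n]_q!=[n]_q[n-1]_q\cdots[1]_q$, $[0]_q!=1$. Put $E_q(x)=\sum_{n=0}^{\infty}q^{n(n-1)/2}\frac{x^n}{[n]_q!}$ (an entire function) and $e_q(x)=\sum_{n=0}^{\infty}\frac{x^n}{[n]_q!}$ wherever this series converges (i.e. $|x|<\frac1{1-q}$). The Jackson $q$-integral is $\int_0^{\infty}f(t)\,d_qt=(1-q)\sum_{k\in\mathbb{Z}}q^kf(q^k)$, provided the sum converges absolutely. The $q$-Natural transform of first kind is, for $u,v>0$, $$(N_qf)(u;v)=\frac1u\int_0^{\infty}f(t)\,E_q\!\left(-q\frac{v}{u}t\right)d_qt=\frac{1-q}{u}\sum_{k\in\mathbb{Z}}q^kf(q^k)E_q\!\left(-q^{k+1}\frac{v}{u}\right).$$ Terms for which the factor $E_q(-q^{k+1}v/u)$ vanishes are taken to be $0$ (even if $f(q^k)$ is not defined). The $q$-integral is said to exist at $(u;v)$ if $f(q^k)$ is defined for every other $k$ and the series converges absolutely. $N_qe_q(at)$ denotes the transform of $t\mapsto e_q(at)$. *)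

theory Defs
  imports Complex_Main "HOL-Analysis.Infinite_Sum"
begin

definition q_number :: "real \<Rightarrow> nat \<Rightarrow> real" where
  "q_number q n = (1 - q ^ n) / (1 - q)"

definition q_fact :: "real \<Rightarrow> nat \<Rightarrow> real" where
  "q_fact q n = (\<Prod>i=1..n. q_number q i)"

definition E_q :: "real \<Rightarrow> real \<Rightarrow> real" where
  "E_q q x = (\<Sum>n. q ^ (n * (n - 1) div 2) * x ^ n / q_fact q n)"

text \<open>A partial function: undefined where the series diverges, that is (for \<open>0 < q < 1\<close>)
  where \<open>\<bar>x\<bar> \<ge> 1 / (1 - q)\<close>.\<close>

definition e_q :: "real \<Rightarrow> real \<rightharpoonup> real" where
  "e_q q x = (if summable (\<lambda>n. x ^ n / q_fact q n)
              then Some (\<Sum>n. x ^ n / q_fact q n) else None)"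

text \<open>The Jackson integral over the positive half-line of a partial function, which has to be
  defined at all the points \<open>q\<^sup>k\<close> with \<open>k\<close> an integer.\<close>

definition jackson_integrable :: "real \<Rightarrow> (real \<rightharpoonup> real) \<Rightarrow> bool" where
  "jackson_integrable q f \<longleftrightarrow>
     (\<forall>k::int. q powi k \<in> dom f) \<and>
     (\<lambda>k::int. q powi k * the (f (q powi k))) abs_summable_on UNIV"

definition jackson_integral :: "real \<Rightarrow> (real \<rightharpoonup> real) \<Rightarrow> real" where
  "jackson_integral q f = (1 - q) * (\<Sum>\<^sub>\<infinity>k::int. q powi k * the (f (q powi k)))"

text \<open>The integrand \<open>f t * E_q (- q * (v / u) * t)\<close>, with value \<open>0\<close> wherever the second factor
  vanishes, even if \<open>f t\<close> is undefined.\<close>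

definition q_natural_integrand ::
    "real \<Rightarrow> (real \<rightharpoonup> real) \<Rightarrow> real \<Rightarrow> real \<Rightarrow> (real \<rightharpoonup> real)" where
  "q_natural_integrand q f u v t =
     (if E_q q (- q * (v / u) * t) = 0 then Some 0
      else map_option (\<lambda>y. y * E_q q (- q * (v / u) * t)) (f t))"

definition q_natural_exists :: "real \<Rightarrow> (real \<rightharpoonup> real) \<Rightarrow> real \<Rightarrow> real \<Rightarrow> bool" where
  "q_natural_exists q f u v \<longleftrightarrow> jackson_integrable q (q_natural_integrand q f u v)"

definition q_natural :: "real \<Rightarrow> (real \<rightharpoonup> real) \<Rightarrow> real \<Rightarrow> real \<Rightarrow> real" where
  "q_natural q f u v = 1 / u * jackson_integral q (q_natural_integrand q f u v)"

end

theory Submission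
  imports Defs
begin

text \<open>Put \<open>b = v / u\<close>. The integrand has a \<open>q\<close>-antiderivative: comparing coefficients gives
  \<open>e\<^sub>q(x) - e\<^sub>q(q x) = (1 - q) x e\<^sub>q(x)\<close> and \<open>E\<^sub>q(x) - E\<^sub>q(q x) = (1 - q) x E\<^sub>q(q x)\<close>
  (\<open>e_q_functional_equation\<close>, \<open>E_q_functional_equation\<close>), so
  \<open>G(t) = e\<^sub>q(a t) E\<^sub>q(- b t)\<close> satisfies
  \<open>(b - a) (1 - q) t e\<^sub>q(a t) E\<^sub>q(- q b t) = G(q t) - G(t)\<close>.
  Hence the Jackson sum telescopes (\<open>infsum_int_eq_telescope\<close>). At the end \<open>t \<rightarrow> 0\<close>,
  continuity of the two power series gives \<open>G \<rightarrow> 1\<close>.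

  At the other end the existence hypothesis does the work. The series of \<open>e\<^sub>q(x)\<close> diverges for
  \<open>x \<ge> 1 / (1 - q)\<close>, so the integral can exist only if \<open>E\<^sub>q(- q b q\<^sup>k)\<close> vanishes for some \<open>k\<close>.
  By the functional equation the zeros of \<open>k \<mapsto> E\<^sub>q(- b q\<^sup>k)\<close> are closed downwards, and
  they are bounded above because \<open>E\<^sub>q(0) = 1\<close>; so they are exactly the integers \<open>k \<le> m\<close> for some
  \<open>m\<close>. The integrand is therefore supported on \<open>k \<ge> m\<close>, where \<open>e\<^sub>q\<close> is defined, and
  \<open>G(q\<^sup>m) = 0\<close>. The increments of \<open>G\<close> thus add up to \<open>1\<close>, so the integral is \<open>1 / (b - a)\<close>,
  and dividing by \<open>u\<close> gives \<open>1 / (v - a u)\<close>.\<close>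

section \<open>Bounds on q-factorials\<close>

lemma q_number_bounds:
  assumes "0 < q" "q < 1" "1 \<le> n"
  shows "1 \<le> q_number q n" "q_number q n \<le> 1 / (1 - q)"
proof -
  have "q ^ n \<le> q ^ 1"
    using assms by (intro power_decreasing) auto
  then show "1 \<le> q_number q n"
    using assms by (simp add: q_number_def)
  show "q_number q n \<le> 1 / (1 - q)"
    unfolding q_number_def using assms by (intro divide_right_mono) auto
qed

lemma q_fact_0 [simp]: "q_fact q 0 = 1"
  by (simp add: q_fact_def)

lemma q_fact_Suc: "q_fact q (Suc n) = q_fact q n * q_number q (Suc n)"
  by (simp add: q_fact_def)

lemma q_fact_pos:
  assumes "0 < q" "q < 1"
  shows "0 < q_fact q n"
  unfolding q_fact_def
proof (rule prod_pos)
  fix i assume "i \<in> {1..n}"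
  then show "0 < q_number q i" using q_number_bounds(1)[OF assms, of i] by simp
qed

lemma q_fact_le:
  assumes "0 < q" "q < 1"
  shows "q_fact q n \<le> (1 / (1 - q)) ^ n"
proof -
  have "q_fact q n \<le> (\<Prod>i=1..n. 1 / (1 - q))"
    unfolding q_fact_def
  proof (rule prod_mono)
    fix i assume "i \<in> {1..n}"
    then show "0 \<le> q_number q i \<and> q_number q i \<le> 1 / (1 - q)"
      using q_number_bounds[OF assms, of i] by simp
  qed
  then show ?thesis by simp
qed

lemma q_fact_recurrence:
  assumes "0 < q" "q < 1"
  shows "(1 - q ^ Suc n) / q_fact q (Suc n) = (1 - q) / q_fact q n"
  using q_fact_pos[OF assms, of n] q_fact_pos[OF assms, of "Suc n"] assms
  by (simp add: q_fact_Suc q_number_def field_simps)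

section \<open>Power series and their q-differences\<close>

text \<open>This is termwise \<open>q\<close>-differentiation; the coefficients \<open>d\<close> are those of the \<open>q\<close>-derivative.\<close>

lemma powser_q_difference:
  fixes c d :: "nat \<Rightarrow> real"
  assumes "summable (\<lambda>n. c n * x ^ n)" "summable (\<lambda>n. c n * (q * x) ^ n)"
    and "summable (\<lambda>n. d n * x ^ n)"
    and coeff: "\<And>n. (1 - q ^ Suc n) * c (Suc n) = (1 - q) * d n"
  shows "(\<Sum>n. c n * x ^ n) - (\<Sum>n. c n * (q * x) ^ n) = (1 - q) * x * (\<Sum>n. d n * x ^ n)"
proof -
  define h where "h n = c n * x ^ n - c n * (q * x) ^ n" for n
  have h_Suc: "h (Suc n) = (1 - q) * x * (d n * x ^ n)" for n
  proof -
    have "h (Suc n) = ((1 - q ^ Suc n) * c (Suc n)) * x ^ Suc n"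
      unfolding h_def power_mult_distrib by (simp only: algebra_simps)
    then show ?thesis by (simp add: coeff del: power_Suc) simp
  qed
  have "summable h"
    unfolding h_def using assms(1,2) by (rule summable_diff)
  then have "suminf h = (\<Sum>n. h (Suc n))"
    using suminf_split_head[of h] by (simp only: h_def) simp
  also have "\<dots> = (1 - q) * x * (\<Sum>n. d n * x ^ n)"
    unfolding h_Suc using assms(3) by (rule suminf_mult)
  finally show ?thesis
    unfolding h_def using suminf_diff[OF assms(1,2)] by simp
qed

lemma powser_tendsto_at_0:
  fixes c :: "nat \<Rightarrow> real"
  assumes "summable (\<lambda>n. c n * K ^ n)" "K \<noteq> 0" and "X \<longlonglongrightarrow> 0"
  shows "(\<lambda>i. \<Sum>n. c n * X i ^ n) \<longlonglongrightarrow> c 0"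
proof -
  have "isCont (\<lambda>x. \<Sum>n. c n * x ^ n) 0"
    using assms by (intro isCont_powser[OF assms(1)]) simp
  from isCont_tendsto_compose[OF this assms(3)] show ?thesis by simp
qed

section \<open>The q-exponential functions\<close>

lemma E_q_altdef: "E_q q x = (\<Sum>n. (q ^ (n * (n - 1) div 2) / q_fact q n) * x ^ n)"
  by (simp add: E_q_def)

lemma triangular_Suc: "Suc n * (Suc n - 1) div 2 = n * (n - 1) div 2 + n"
proof -
  have "Suc n * (Suc n - 1) = n * (n - 1) + n * 2"
    by (cases n) (auto simp: algebra_simps)
  then show ?thesis by simp
qed

lemma summable_E_q:
  assumes "0 < q" "q < 1"
  shows "summable (\<lambda>n. (q ^ (n * (n - 1) div 2) / q_fact q n) * x ^ n)" (is "summable ?f")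
proof -
  have "(\<lambda>n. q ^ n * \<bar>x\<bar>) \<longlonglongrightarrow> 0 * \<bar>x\<bar>"
    using assms by (intro tendsto_mult LIMSEQ_realpow_zero tendsto_const) auto
  then have "\<forall>\<^sub>F n in sequentially. q ^ n * \<bar>x\<bar> < 1 / 2"
    by (rule order_tendstoD) simp
  then obtain N where N: "\<And>n. n \<ge> N \<Longrightarrow> q ^ n * \<bar>x\<bar> < 1 / 2"
    unfolding eventually_sequentially by blast
  show ?thesis
  proof (rule summable_ratio_test[of "1 / 2" N])
    fix n assume n: "N \<le> n"
    have "?f (Suc n) = ?f n * (q ^ n * x / q_number q (Suc n))"
      unfolding triangular_Suc power_add q_fact_Suc by simp
    then have "norm (?f (Suc n)) = norm (?f n) * norm (q ^ n * x / q_number q (Suc n))"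
      by (simp only: norm_mult)
    also have "norm (q ^ n * x / q_number q (Suc n)) \<le> 1 / 2"
    proof -
      have "1 \<le> q_number q (Suc n)" using q_number_bounds(1)[OF assms] by simp
      then have "norm (q ^ n * x / q_number q (Suc n)) \<le> q ^ n * \<bar>x\<bar> / 1"
        using assms unfolding real_norm_def abs_divide abs_mult by (intro frac_le) auto
      with N[OF n] show ?thesis by linarith
    qed
    then have "norm (?f n) * norm (q ^ n * x / q_number q (Suc n)) \<le> norm (?f n) * (1 / 2)"
      by (intro mult_left_mono) auto
    finally show "norm (?f (Suc n)) \<le> 1 / 2 * norm (?f n)" by simp
  qed simp
qed

lemma E_q_functional_equation:
  assumes "0 < q" "q < 1"
  shows "E_q q x = (1 + (1 - q) * x) * E_q q (q * x)"
proof -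
  let ?c = "\<lambda>n. q ^ (n * (n - 1) div 2) / q_fact q n"
  have scale: "?c n * q ^ n * x ^ n = ?c n * (q * x) ^ n" for n
    by (simp add: power_mult_distrib)
  have "(\<Sum>n. ?c n * x ^ n) - (\<Sum>n. ?c n * (q * x) ^ n)
      = (1 - q) * x * (\<Sum>n. ?c n * q ^ n * x ^ n)"
  proof (rule powser_q_difference)
    fix n
    have "(1 - q ^ Suc n) * ?c (Suc n)
        = q ^ (n * (n - 1) div 2) * q ^ n * ((1 - q ^ Suc n) / q_fact q (Suc n))"
      unfolding triangular_Suc power_add by simp
    then show "(1 - q ^ Suc n) * ?c (Suc n) = (1 - q) * (?c n * q ^ n)"
      unfolding q_fact_recurrence[OF assms] by simp
  qed (simp_all only: scale summable_E_q[OF assms])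
  then show ?thesis
    unfolding scale E_q_altdef by (simp only: algebra_simps)
qed

lemma E_q_tendsto_at_0:
  assumes "0 < q" "q < 1" "X \<longlonglongrightarrow> 0"
  shows "(\<lambda>i. E_q q (X i)) \<longlonglongrightarrow> 1"
  using powser_tendsto_at_0[OF summable_E_q[OF assms(1,2), of 1] _ assms(3)]
  by (simp add: E_q_altdef)

lemma e_q_defined_iff: "x \<in> dom (e_q q) \<longleftrightarrow> summable (\<lambda>n. (1 / q_fact q n) * x ^ n)"
  by (auto simp: e_q_def split: if_splits)

lemma the_e_q:
  assumes "x \<in> dom (e_q q)"
  shows "the (e_q q x) = (\<Sum>n. (1 / q_fact q n) * x ^ n)"
  using assms by (auto simp: e_q_def split: if_splits)

text \<open>Since \<open>[n]\<^sub>q! \<le> (1 - q)\<^sup>-\<^sup>n\<close>, the terms of the series are at least \<open>1\<close> here.\<close>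

lemma e_q_undefined:
  assumes "0 < q" "q < 1" "1 / (1 - q) \<le> x"
  shows "x \<notin> dom (e_q q)"
proof
  assume "x \<in> dom (e_q q)"
  then have "(\<lambda>n. (1 / q_fact q n) * x ^ n) \<longlonglongrightarrow> 0"
    unfolding e_q_defined_iff by (rule summable_LIMSEQ_zero)
  moreover have "1 \<le> (1 / q_fact q n) * x ^ n" for n
  proof -
    have "(1 / (1 - q)) ^ n \<le> x ^ n"
      using assms by (intro power_mono) auto
    then have "q_fact q n \<le> x ^ n"
      using q_fact_le[OF assms(1,2), of n] by linarith
    then show ?thesis using q_fact_pos[OF assms(1,2), of n] by simp
  qed
  ultimately have "(1::real) \<le> 0" by (intro LIMSEQ_le_const) auto
  then show False by simp
qed

lemma e_q_functional_equation:
  assumes "0 < q" "q < 1" "x \<in> dom (e_q q)" "q * x \<in> dom (e_q q)"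
  shows "the (e_q q (q * x)) = (1 - (1 - q) * x) * the (e_q q x)"
proof -
  let ?c = "\<lambda>n. 1 / q_fact q n"
  have "(\<Sum>n. ?c n * x ^ n) - (\<Sum>n. ?c n * (q * x) ^ n) = (1 - q) * x * (\<Sum>n. ?c n * x ^ n)"
  proof (rule powser_q_difference)
    fix n
    show "(1 - q ^ Suc n) * ?c (Suc n) = (1 - q) * ?c n"
      using q_fact_recurrence[OF assms(1,2), of n] by simp
  qed (use assms(3,4) e_q_defined_iff in blast)+
  then show ?thesis
    unfolding the_e_q[OF assms(3)] the_e_q[OF assms(4)] by (simp only: algebra_simps)
qed

lemma e_q_tendsto_at_0:
  assumes "x \<in> dom (e_q q)" "x \<noteq> 0" "X \<longlonglongrightarrow> 0" "\<And>i. X i \<in> dom (e_q q)"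
  shows "(\<lambda>i. the (e_q q (X i))) \<longlonglongrightarrow> 1"
proof -
  have "(\<lambda>i. \<Sum>n. (1 / q_fact q n) * X i ^ n) \<longlonglongrightarrow> 1 / q_fact q 0"
    using assms(1-3) unfolding e_q_defined_iff by (rule powser_tendsto_at_0)
  then show ?thesis by (simp add: the_e_q[OF assms(4)])
qed

section \<open>Telescoping sums over the integers\<close>

lemma downward_closed_int_set_eq_atMost:
  fixes A :: "int set"
  assumes down: "\<And>k. k + 1 \<in> A \<Longrightarrow> k \<in> A" and "k0 \<in> A" and "N \<notin> A"
  obtains m where "A = {..m}"
proof -
  have le: "j \<in> A" if "j \<le> k" "k \<in> A" for j k
    using that
  proof (induction j rule: int_le_induct)
    case (step i)
    then show ?case using down[of "i - 1"] by simp
  qed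
  define n where "n = (LEAST n::nat. k0 + int n \<notin> A)"
  have "k0 < N" using le[of N k0] assms(2,3) by force
  then have "k0 + int (nat (N - k0)) \<notin> A" using assms(3) by simp
  then have notin: "k0 + int n \<notin> A" unfolding n_def by (rule LeastI)
  with assms(2) have "n \<noteq> 0" by (metis add.right_neutral of_nat_0)
  then have "k0 + int (n - 1) \<in> A"
    unfolding n_def using not_less_Least diff_less zero_less_one by blast
  then have max: "k0 + int n - 1 \<in> A" using \<open>n \<noteq> 0\<close> by (simp add: of_nat_diff algebra_simps)
  have "A = {..k0 + int n - 1}"
  proof (intro equalityI subsetI)
    fix k assume "k \<in> A"
    then show "k \<in> {..k0 + int n - 1}" using le[of "k0 + int n" k] notin by force
  next
    fix k assume "k \<in> {..k0 + int n - 1}"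
    then have "k \<le> k0 + int n - 1" by simp
    then show "k \<in> A" using max by (rule le)
  qed
  then show ?thesis using that by blast
qed

lemma powi_tendsto_0:
  fixes q :: real
  assumes "0 < q" "q < 1"
  shows "(\<lambda>n. q powi (m + int n)) \<longlonglongrightarrow> 0"
proof -
  have "(\<lambda>n. q powi m * q ^ n) \<longlonglongrightarrow> q powi m * 0"
    using assms by (intro tendsto_mult LIMSEQ_realpow_zero tendsto_const) auto
  then show ?thesis using assms by (simp add: power_int_add)
qed

lemma infsum_int_eq_telescope:
  fixes f :: "int \<Rightarrow> real"
  assumes "f summable_on UNIV" and zero: "\<And>k. k < m \<Longrightarrow> f k = 0"
    and tele: "\<And>n. f (m + int n) = G (Suc n) - G n" and "G \<longlonglongrightarrow> L"
  shows "(\<Sum>\<^sub>\<infinity>k. f k) = L - G 0"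
proof -
  have reindex: "bij_betw (\<lambda>n. m + int n) UNIV {m..}"
    by (rule bij_betwI[where g = "\<lambda>k. nat (k - m)"]) auto
  have "(f has_sum (\<Sum>\<^sub>\<infinity>k. f k)) UNIV" using assms(1) by simp
  then have "(f has_sum (\<Sum>\<^sub>\<infinity>k. f k)) {m..}"
    by (rule has_sum_cong_neutral[THEN iffD1, rotated -1]) (auto simp: zero)
  then have "((\<lambda>n. f (m + int n)) has_sum (\<Sum>\<^sub>\<infinity>k. f k)) UNIV"
    by (simp add: has_sum_reindex_bij_betw[OF reindex])
  then have "(\<lambda>n. f (m + int n)) sums (\<Sum>\<^sub>\<infinity>k. f k)" by (rule has_sum_imp_sums)
  moreover have "(\<lambda>n. f (m + int n)) sums (L - G 0)"
    unfolding tele using assms(4) by (rule telescope_sums)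
  ultimately show ?thesis by (rule sums_unique2)
qed

section \<open>The q-Natural transform of the q-exponential\<close>

theorem lemma2:
  fixes q a u v :: real
  assumes "0 < q" and "q < 1"
    and "0 < a" and "0 < u" and "0 < v"
    and "a * u < v"
    and "q_natural_exists q (\<lambda>t. e_q q (a * t)) u v"
  shows "q_natural q (\<lambda>t. e_q q (a * t)) u v = 1 / (v - a * u)"
proof -
  note q = assms(1,2)
  define b where "b = v / u"
  define E where "E k = E_q q (- b * q powi k)" for k :: int
  define e where "e k = the (e_q q (a * q powi k))" for k :: int
  define F where "F = q_natural_integrand q (\<lambda>t. e_q q (a * t)) u v"
  have powi_Suc: "q powi (k + 1) = q * q powi k" for k
    using q by (simp add: power_int_add)
  have E_arg: "E_q q (- q * (v / u) * q powi k) = E (k + 1)" for k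
    unfolding E_def b_def powi_Suc by (simp add: mult_ac)
  have F_integrable: "jackson_integrable q F"
    using assms(7) by (simp add: q_natural_exists_def F_def)
  then have F_dom: "q powi k \<in> dom F" for k
    by (simp add: jackson_integrable_def)
  have F_summable: "(\<lambda>k. q powi k * the (F (q powi k))) summable_on UNIV"
    using F_integrable unfolding jackson_integrable_def by (blast intro: abs_summable_summable)
  have F_powi: "F (q powi k) = (if E (k + 1) = 0 then Some 0
      else map_option (\<lambda>y. y * E (k + 1)) (e_q q (a * q powi k)))" for k
    unfolding F_def q_natural_integrand_def E_arg ..
  have e_dom: "a * q powi k \<in> dom (e_q q)" if "E (k + 1) \<noteq> 0" for k
    using F_dom[of k] that by (auto simp: F_powi dom_def)
  have F_eq: "the (F (q powi k)) = e k * E (k + 1)" if "E (k + 1) \<noteq> 0" for k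
    using e_dom[OF that] that by (auto simp: F_powi e_def dom_def)
  have F_zero: "the (F (q powi k)) = 0" if "E (k + 1) = 0" for k
    using that by (simp add: F_powi)

  have E_step: "E k = (1 - (1 - q) * b * q powi k) * E (k + 1)" for k
    unfolding E_def powi_Suc using E_q_functional_equation[OF q, of "- b * q powi k"]
    by (simp add: mult_ac)
  have E_lim: "(\<lambda>n. E (m + int n)) \<longlonglongrightarrow> 1" for m
    unfolding E_def
    using tendsto_mult[OF tendsto_const powi_tendsto_0[OF q], of "- b"]
    by (intro E_q_tendsto_at_0[OF q]) simp
  \<comment> \<open>Where \<open>e_q\<close> is undefined, existence of the integral forces the other factor to vanish.\<close>
  obtain n where "1 / (1 - q) / a < (1 / q) ^ n"
    using real_arch_pow[of "1 / q" "1 / (1 - q) / a"] q by auto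
  then have "1 / (1 - q) < a * (1 / q) ^ n"
    unfolding pos_divide_less_eq[OF assms(3)] by (simp only: mult.commute)
  then have "1 / (1 - q) \<le> a * q powi (- int n)"
    by (simp add: power_int_minus power_one_over inverse_eq_divide)
  then have "a * q powi (- int n) \<notin> dom (e_q q)" by (rule e_q_undefined[OF q])
  then have zero: "- int n + 1 \<in> {k. E k = 0}" using e_dom by blast
  have "\<forall>\<^sub>F n in sequentially. 0 < E (0 + int n)"
    using E_lim by (rule order_tendstoD) simp
  then obtain N where "0 < E (int N)"
    by (auto simp: eventually_sequentially)
  then have nonzero: "int N \<notin> {k. E k = 0}" by simp
  have "k \<in> {k. E k = 0}" if "k + 1 \<in> {k. E k = 0}" for k
    using that E_step[of k] by simp
  then obtain m where "{k. E k = 0} = {..m}"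
    using downward_closed_int_set_eq_atMost[OF _ zero nonzero] by blast
  then have E_zero: "E k = 0 \<longleftrightarrow> k \<le> m" for k by blast
  have dom_m: "a * q powi (m + int n) \<in> dom (e_q q)" for n
    by (rule e_dom) (simp add: E_zero)

  \<comment> \<open>The \<open>q\<close>-antiderivative at \<open>q\<^sup>m\<^sup>+\<^sup>n\<close>, scaled so that its increments are the terms of the sum.\<close>
  define G where "G n = e (m + int n) * E (m + int n) / ((1 - q) * (b - a))" for n
  have "a < b" using assms by (simp add: b_def field_simps)
  have e_step: "e (m + int n + 1) = (1 - (1 - q) * a * q powi (m + int n)) * e (m + int n)" for n
  proof -
    have shift: "q * (a * q powi (m + int n)) = a * q powi (m + int n + 1)"
      unfolding powi_Suc by simp
    have "a * q powi (m + int n + 1) \<in> dom (e_q q)"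
      using dom_m[of "Suc n"] by (simp add: add_ac)
    then show ?thesis
      using e_q_functional_equation[OF q dom_m[of n]] unfolding shift e_def
      by (simp add: mult.assoc)
  qed
  have e_lim: "(\<lambda>n. e (m + int n)) \<longlonglongrightarrow> 1"
    unfolding e_def
  proof (rule e_q_tendsto_at_0)
    show "a * q powi m \<in> dom (e_q q)" using dom_m[of 0] by simp
    show "a * q powi m \<noteq> 0" using assms by simp
    show "(\<lambda>n. a * q powi (m + int n)) \<longlonglongrightarrow> 0"
      using tendsto_mult[OF tendsto_const powi_tendsto_0[OF q], of a] by simp
  qed (rule dom_m)
  have "(\<Sum>\<^sub>\<infinity>k. q powi k * the (F (q powi k))) = 1 * 1 / ((1 - q) * (b - a)) - G 0"
  proof (rule infsum_int_eq_telescope[OF F_summable])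
    fix k assume "k < m"
    then show "q powi k * the (F (q powi k)) = 0" using F_zero E_zero by simp
  next
    fix n
    let ?k = "m + int n"
    have "e (?k + 1) * E (?k + 1) - e ?k * E ?k
        = (1 - q) * (b - a) * (q powi ?k * (e ?k * E (?k + 1)))"
      unfolding e_step E_step[of ?k] by (simp add: algebra_simps)
    moreover have "the (F (q powi ?k)) = e ?k * E (?k + 1)"
      by (rule F_eq) (simp add: E_zero)
    ultimately show "q powi ?k * the (F (q powi ?k)) = G (Suc n) - G n"
      using q \<open>a < b\<close> by (simp add: G_def flip: diff_divide_distrib) (simp add: add_ac)
  next
    show "G \<longlonglongrightarrow> 1 * 1 / ((1 - q) * (b - a))"
      unfolding G_def using q \<open>a < b\<close>
      by (intro tendsto_divide tendsto_mult e_lim E_lim tendsto_const) auto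
  qed
  moreover have "G 0 = 0" by (simp add: G_def E_zero)
  ultimately have "jackson_integral q F = 1 / (b - a)"
    unfolding jackson_integral_def using q by simp
  then show ?thesis
    unfolding q_natural_def F_def[symmetric] using assms by (simp add: b_def field_simps)
qed

end
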